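(* Let $r,s,t>1$ be integers and $G=C_r*C_s*C_t$. Let $\mathbb F$ be a field of characteristic $0$ containing a root $\mu_1$ of $P_r$, a root $\mu_2$ of $P_s$, a root $\mu_3$ of $P_t$, and elements $s_1,s_2,s_3$ with $s_i^2+\mu_i^2=1$ for $i=1,2,3$ (then each $s_i\neq0$). Let $A=\mathbb F[x,y,u,v]/\langle(1-x^2)(1-y^2)-(u^2+v^2)\rangle$, let $J\lhd A$ be the ideal generated by $u,v,1-x^2,1-y^2$, let $$W=-s_1^2s_2s_3\,xy+\mu_1\mu_3s_1s_2\,x+\mu_1\mu_2s_1s_3\,y+s_1^2\mu_2\mu_3\in A,$$ and let $$M=\begin{pmatrix}u&v&1-x^2&0\\-v&u&0&1-x^2\\1-y^2&0&u&-v\\0&1-y^2&v&u\end{pmatrix}.$$ Suppose that for every $a\in A$ represented by $M$ and every $\alpha\in J$, the elements $a$ and $W+\alpha$ generate a proper ideal of $A$. Then no element $w\in G$ normally generates $G$.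
   Context: The polynomials $P_n\in\mathbb Q[X]$, $n\in\mathbb Z$, are defined by $P_0=0$, $P_1=1$ and $2XP_n(X)=P_{n-1}(X)+P_{n+1}(X)$. An element $a\in A$ is said to be represented by $M$ if there exist column vectors $\mathbf q_1,\mathbf q_2\in A^4$ with $a=\mathbf q_1^{T}M\mathbf q_2$. *)

theory Defs
  imports "HOL-Computational_Algebra.Polynomial" "HOL-Algebra.Coset"
begin

fun Pch :: "nat \<Rightarrow> 'a::comm_ring_1 poly" where
  "Pch 0 = 0"
| "Pch (Suc 0) = 1"
| "Pch (Suc (Suc n)) = [:0, 2:] * Pch (Suc n) - Pch n"

type_synonym 'a mpoly4 = "'a poly poly poly poly"

definition C4 :: "'a::comm_ring_1 \<Rightarrow> 'a mpoly4" where
  "C4 c = [:[:[:[:c:]:]:]:]"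
definition Xv :: "'a::comm_ring_1 mpoly4" where "Xv = [:[:[:[:0, 1:]:]:]:]"
definition Yv :: "'a::comm_ring_1 mpoly4" where "Yv = [:[:[:0, 1:]:]:]"
definition Uv :: "'a::comm_ring_1 mpoly4" where "Uv = [:[:0, 1:]:]"
definition Vv :: "'a::comm_ring_1 mpoly4" where "Vv = [:0, 1:]"

text \<open>The defining relation of A = F[x,y,u,v] / <R>.\<close>
definition Rrel :: "'a::comm_ring_1 mpoly4" where
  "Rrel = (1 - Xv^2) * (1 - Yv^2) - (Uv^2 + Vv^2)"

definition Mmat :: "nat \<Rightarrow> nat \<Rightarrow> 'a::comm_ring_1 mpoly4" where
  "Mmat i j = [[Uv, Vv, 1 - Xv^2, 0],
               [- Vv, Uv, 0, 1 - Xv^2],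
               [1 - Yv^2, 0, Uv, - Vv],
               [0, 1 - Yv^2, Vv, Uv]] ! i ! j"

text \<open>q1^T M q2 for column vectors q1, q2 (given by representatives in F[x,y,u,v]).\<close>
definition bilinM :: "(nat \<Rightarrow> 'a::comm_ring_1 mpoly4) \<Rightarrow> (nat \<Rightarrow> 'a mpoly4) \<Rightarrow> 'a mpoly4" where
  "bilinM q1 q2 = (\<Sum>i<4. \<Sum>j<4. q1 i * Mmat i j * q2 j)"

definition Wel :: "'a::comm_ring_1 \<Rightarrow> 'a \<Rightarrow> 'a \<Rightarrow> 'a \<Rightarrow> 'a \<Rightarrow> 'a \<Rightarrow> 'a mpoly4" where
  "Wel m1 m2 m3 s1 s2 s3 =
     C4 (- (s1^2 * s2 * s3)) * Xv * Yv + C4 (m1 * m3 * s1 * s2) * Xv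
     + C4 (m1 * m2 * s1 * s3) * Yv + C4 (s1^2 * m2 * m3)"

definition ord3 :: "nat \<Rightarrow> nat \<Rightarrow> nat \<Rightarrow> nat \<Rightarrow> nat" where
  "ord3 r s t i = (if i = 0 then r else if i = 1 then s else t)"

text \<open>Reduced words: letters (i,k) standing for g_i^k with 0<k<ord i,
  consecutive letters from different factors.\<close>
definition fp_words :: "(nat \<Rightarrow> nat) \<Rightarrow> (nat \<times> nat) list set" where
  "fp_words N = {ws. (\<forall>(i, k) \<in> set ws. i < 3 \<and> 0 < k \<and> k < N i) \<and>
                     (\<forall>j. Suc j < length ws \<longrightarrow> fst (ws ! j) \<noteq> fst (ws ! Suc j))}"

fun fp_cons :: "(nat \<Rightarrow> nat) \<Rightarrow> nat \<times> nat \<Rightarrow> (nat \<times> nat) list \<Rightarrow> (nat \<times> nat) list" where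
  "fp_cons N (i, k) ws =
     (if k mod N i = 0 then ws else
      (case ws of
         [] \<Rightarrow> [(i, k mod N i)]
       | (j, l) # ws' \<Rightarrow>
           (if i = j then (if (k + l) mod N i = 0 then ws' else (i, (k + l) mod N i) # ws')
            else (i, k mod N i) # ws)))"

definition fp_mult :: "(nat \<Rightarrow> nat) \<Rightarrow> (nat \<times> nat) list \<Rightarrow> (nat \<times> nat) list \<Rightarrow> (nat \<times> nat) list" where
  "fp_mult N xs ys = foldr (fp_cons N) xs ys"

definition free_prod3 :: "nat \<Rightarrow> nat \<Rightarrow> nat \<Rightarrow> (nat \<times> nat) list monoid" where
  "free_prod3 r s t =
     \<lparr>carrier = fp_words (ord3 r s t), mult = fp_mult (ord3 r s t), one = []\<rparr>"

definition normally_generates :: "('g, 'b) monoid_scheme \<Rightarrow> 'g \<Rightarrow> bool" where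
  "normally_generates G w \<longleftrightarrow>
     w \<in> carrier G \<and> (\<forall>N. N \<lhd> G \<and> w \<in> N \<longrightarrow> N = carrier G)"

end

theory Submission
  imports Defs "HOL-Number_Theory.Cong"
begin

text \<open>
  A cyclic group of order \<open>n\<close> acts by powers of a quaternion \<open>\<mu> + \<sigma> a\<close> of norm one, \<open>a\<close> a unit axis, with
  \<open>P\<^sub>n(\<mu>) = 0\<close>, since its \<open>n\<close>-th power is then \<open>\<plusminus>1\<close>. Three such quaternions with generic axes give
  a representation of the free product modulo sign; modulo rotation about the first axis, its
  entries depend on the cosines \<open>x, y\<close> of the second and third axis against the first and on the
  product \<open>u + iv\<close> of their orthogonal components, and \<open>A\<close> is the ring of these functions.

  If \<open>w\<close> normally generates, its exponent sums are prime to the orders, so after replacing the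
  generating quaternions by suitable powers one may take all exponent sums to be \<open>1\<close>. Write \<open>c\<close> for
  the component of the image of \<open>w\<close> along the first axis. Modulo \<open>J\<close> the representation is
  commutative, which gives \<open>s\<^sub>1 c = \<plusminus>W + \<alpha>\<close>. Let \<open>I\<close> be generated by \<open>c\<close> and the products of the
  orthogonal part of the image of \<open>w\<close> with those of the second and third axis; these are the
  entries of \<open>M q\<close> for a vector \<open>q\<close>. Modulo \<open>I\<close> the image of \<open>w\<close> is a scalar, hence so is that of
  the whole group; the first generator shows that \<open>s\<^sub>1\<close> lies in \<open>I\<close>, and \<open>I\<close> is the unit ideal.
\<close>

section \<open>The free product as a group\<close>

lemma fp_words_Nil [simp]: "[] \<in> fp_words N"
  by (simp add: fp_words_def)

lemma fp_words_Cons: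
  "(i, k) # ws \<in> fp_words N \<longleftrightarrow>
     i < 3 \<and> 0 < k \<and> k < N i \<and> ws \<in> fp_words N \<and> (ws = [] \<or> fst (hd ws) \<noteq> i)"
proof -
  have split: "(\<forall>j. Q j) \<longleftrightarrow> Q 0 \<and> (\<forall>j. Q (Suc j))" for Q :: "nat \<Rightarrow> bool"
    by (metis not0_implies_Suc)
  have "(\<forall>j. Suc j < length ((i, k) # ws) \<longrightarrow>
          fst (((i, k) # ws) ! j) \<noteq> fst (((i, k) # ws) ! Suc j)) \<longleftrightarrow>
        (ws = [] \<or> fst (hd ws) \<noteq> i) \<and>
        (\<forall>j. Suc j < length ws \<longrightarrow> fst (ws ! j) \<noteq> fst (ws ! Suc j))"
    by (subst split) (auto simp: hd_conv_nth)
  then show ?thesis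
    unfolding fp_words_def by auto
qed

lemma fp_cons_closed:
  assumes "ws \<in> fp_words N" "i < 3" "0 < N i"
  shows "fp_cons N (i, k) ws \<in> fp_words N"
proof (cases ws)
  case Nil
  then show ?thesis using assms by (auto simp: fp_words_Cons)
next
  case (Cons a ws')
  then show ?thesis using assms by (cases a) (auto simp: fp_words_Cons)
qed

lemma fp_cons_reduced: "(i, k) # ws \<in> fp_words N \<Longrightarrow> fp_cons N (i, k) ws = (i, k) # ws"
  by (cases ws) (auto simp: fp_words_Cons)

lemma fp_cons_mod: "fp_cons N (i, k mod N i) ws = fp_cons N (i, k) ws"
  by (auto split: list.splits simp: mod_simps)

lemma fp_cons_fp_cons:
  assumes "ws \<in> fp_words N"
  shows "fp_cons N (i, k) (fp_cons N (i, l) ws) = fp_cons N (i, k + l) ws"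
proof -
  \<comment> \<open>A leading \<open>i\<close>-syllable of exponent \<open>n\<close>, with 0
    standing for its absence. In this form \<open>fp_cons\<close> is mere addition of exponents
    modulo \<open>N i\<close>.\<close>
  define put where "put n us = (if n = 0 then us else (i, n) # us)" for n and us :: "(nat \<times> nat) list"
  obtain m us where ws: "ws = put m us" and m: "m mod N i = m" and us: "us = [] \<or> fst (hd us) \<noteq> i"
  proof (cases "ws = [] \<or> fst (hd ws) \<noteq> i")
    case True
    then show ?thesis using that[of 0 ws] by (simp add: put_def)
  next
    case False
    then obtain n us where "ws = (i, n) # us" by (cases ws) auto
    then show ?thesis using that[of n us] assms by (auto simp: put_def fp_words_Cons)
  qed
  have step: "fp_cons N (i, k) (put n us) = put ((k + n) mod N i) us" if "n mod N i = n" for k n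
  proof (cases "k mod N i = 0")
    case True
    then have "(k + n) mod N i = n" using that by (metis add_0 mod_add_left_eq)
    then show ?thesis using True by simp
  next
    case False
    then show ?thesis using us by (cases us) (auto simp: put_def)
  qed
  show ?thesis unfolding ws by (simp add: step m mod_simps add.assoc del: fp_cons.simps)
qed

lemma fp_mult_Nil [simp]: "fp_mult N [] ys = ys"
  by (simp add: fp_mult_def)

lemma fp_mult_Cons [simp]: "fp_mult N (x # xs) ys = fp_cons N x (fp_mult N xs ys)"
  by (simp add: fp_mult_def)

lemma fp_mult_closed:
  "xs \<in> fp_words N \<Longrightarrow> ys \<in> fp_words N \<Longrightarrow> fp_mult N xs ys \<in> fp_words N"
proof (induction xs)
  case (Cons x xs)
  then show ?case
    by (cases x) (auto simp: fp_words_Cons simp del: fp_cons.simps intro!: fp_cons_closed)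
qed simp

text \<open>A merge or cancellation inside the left word is matched on the product by
  \<open>fp_cons_fp_cons\<close>. This is the induction step for associativity.\<close>

lemma fp_mult_fp_cons:
  assumes "ws \<in> fp_words N" "zs \<in> fp_words N"
  shows "fp_mult N (fp_cons N (i, k) ws) zs = fp_cons N (i, k) (fp_mult N ws zs)"
proof (cases "k mod N i = 0")
  case True
  then show ?thesis by simp
next
  case k: False
  show ?thesis
  proof (cases ws)
    case Nil
    then show ?thesis using k fp_cons_mod[of N i k zs] by (simp del: fp_cons.simps add: fp_cons.simps[of N i k "[]"])
  next
    case (Cons a ws')
    obtain j l where a: "a = (j, l)" by (cases a)
    have ws': "ws' \<in> fp_words N" using assms Cons a by (auto simp: fp_words_Cons)
    have cl: "fp_mult N ws' zs \<in> fp_words N" using fp_mult_closed ws' assms by blast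
    show ?thesis
    proof (cases "j = i")
      case True
      have "fp_cons N (i, k) (fp_mult N ws zs) = fp_cons N (i, k + l) (fp_mult N ws' zs)"
        using fp_cons_fp_cons[OF cl] Cons a True by (simp del: fp_cons.simps)
      also have "\<dots> = fp_mult N (fp_cons N (i, k) ws) zs"
      proof (cases "(k + l) mod N i = 0")
        case z: True
        then have "fp_cons N (i, k) ws = ws'" using Cons a True k by simp
        then show ?thesis using z by simp
      next
        case z: False
        then have "fp_cons N (i, k) ws = (i, (k + l) mod N i) # ws'" using Cons a True k by simp
        then show ?thesis using fp_cons_mod by (simp del: fp_cons.simps)
      qed
      finally show ?thesis ..
    next
      case False
      then have "fp_cons N (i, k) ws = (i, k mod N i) # ws" using Cons a k by simp
      then show ?thesis using fp_cons_mod by (simp del: fp_cons.simps)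
    qed
  qed
qed

lemma fp_mult_assoc:
  assumes "ys \<in> fp_words N" "zs \<in> fp_words N"
  shows "xs \<in> fp_words N \<Longrightarrow> fp_mult N (fp_mult N xs ys) zs = fp_mult N xs (fp_mult N ys zs)"
proof (induction xs)
  case (Cons x xs)
  then show ?case using assms
    by (cases x) (simp add: fp_words_Cons fp_mult_fp_cons fp_mult_closed del: fp_cons.simps)
qed simp

lemma fp_left_inverse:
  "xs \<in> fp_words N \<Longrightarrow> \<exists>ys \<in> fp_words N. fp_mult N ys xs = []"
proof (induction xs)
  case (Cons x xs)
  obtain i k where x: "x = (i, k)" by (cases x)
  have xs: "xs \<in> fp_words N" "i < 3" "0 < k" "k < N i"
    using Cons.prems x by (auto simp: fp_words_Cons)
  obtain ys where ys: "ys \<in> fp_words N" "fp_mult N ys xs = []" using Cons.IH xs by blast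
  let ?l = "[(i, N i - k)]"
  have l: "?l \<in> fp_words N" using xs by (simp add: fp_words_Cons)
  have "fp_mult N ?l (x # xs) = fp_cons N (i, N i - k) (fp_cons N (i, k) xs)"
    using fp_cons_reduced Cons.prems x by (simp del: fp_cons.simps)
  also have "\<dots> = xs" using xs by (simp add: fp_cons_fp_cons del: fp_cons.simps) simp
  finally have "fp_mult N (fp_mult N ys ?l) (x # xs) = []"
    using fp_mult_assoc[OF l Cons.prems ys(1)] ys(2) by simp
  then show ?case using fp_mult_closed ys l by blast
qed (auto intro: bexI[of _ "[]"])

lemma free_prod3_simps [simp]:
  "carrier (free_prod3 r s t) = fp_words (ord3 r s t)"
  "x \<otimes>\<^bsub>free_prod3 r s t\<^esub> y = fp_mult (ord3 r s t) x y"
  "\<one>\<^bsub>free_prod3 r s t\<^esub> = []"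
  by (simp_all add: free_prod3_def)

lemma group_free_prod3: "group (free_prod3 r s t)"
proof (rule groupI)
  fix x assume "x \<in> carrier (free_prod3 r s t)"
  then show "\<exists>y \<in> carrier (free_prod3 r s t). y \<otimes>\<^bsub>free_prod3 r s t\<^esub> x = \<one>\<^bsub>free_prod3 r s t\<^esub>"
    using fp_left_inverse by simp
qed (simp_all add: fp_mult_closed fp_mult_assoc)

text \<open>The elements of \<open>G\<close> with property \<open>P\<close> form a normal subgroup
  containing \<open>w\<close>, hence all of \<open>G\<close>.\<close>

lemma normally_generates_induct:
  assumes "group G" "normally_generates G w"
    and "P w" "P \<one>\<^bsub>G\<^esub>"
    and "\<And>x y. x \<in> carrier G \<Longrightarrow> y \<in> carrier G \<Longrightarrow> P x \<Longrightarrow> P y \<Longrightarrow> P (x \<otimes>\<^bsub>G\<^esub> y)"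
    and "\<And>x. x \<in> carrier G \<Longrightarrow> P x \<Longrightarrow> P (inv\<^bsub>G\<^esub> x)"
    and "\<And>x y. x \<in> carrier G \<Longrightarrow> y \<in> carrier G \<Longrightarrow> P y \<Longrightarrow> P (x \<otimes>\<^bsub>G\<^esub> y \<otimes>\<^bsub>G\<^esub> inv\<^bsub>G\<^esub> x)"
    and "g \<in> carrier G"
  shows "P g"
proof -
  interpret group G by fact
  let ?N = "{x \<in> carrier G. P x}"
  have "subgroup ?N G" by (rule subgroupI) (use assms in auto)
  then have "?N \<lhd> G" using assms by (auto simp: normal_inv_iff)
  then have "?N = carrier G" using assms unfolding normally_generates_def by blast
  then show ?thesis using assms by blast
qed

section \<open>Exponent sums\<close>

text \<open>Modulo \<open>N i\<close> this is the projection of the free product onto its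
  \<open>i\<close>-th cyclic factor.\<close>

definition expsum :: "nat \<Rightarrow> (nat \<times> nat) list \<Rightarrow> nat" where
  "expsum i ws = (\<Sum>(j, k)\<leftarrow>ws. if j = i then k else 0)"

lemma expsum_simps [simp]:
  "expsum i [] = 0"
  "expsum i ((j, k) # ws) = (if j = i then k else 0) + expsum i ws"
  by (simp_all add: expsum_def)

lemma expsum_fp_cons:
  "[expsum i (fp_cons N (j, k) ws) = (if j = i then k else 0) + expsum i ws] (mod N i)"
proof (cases "k mod N j = 0")
  case True
  then have "[0 + expsum i ws = (if j = i then k else 0) + expsum i ws] (mod N i)"
    by (intro cong_add) (auto simp: cong_def)
  then show ?thesis using True by simp
next
  case False
  have z: "[n = k + l + n] (mod N i)" if "(k + l) mod N i = 0" for l n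
    using cong_add[of 0 "k + l" "N i" n n] that by (simp add: cong_def)
  have m: "[(k + l) mod N i + n = k + l + n] (mod N i)" for l n
    by (intro cong_add) auto
  have m': "[k mod N i + n = k + n] (mod N i)" for n
    by (intro cong_add) auto
  show ?thesis
  proof (cases ws)
    case Nil
    then show ?thesis using False m'[of 0] by auto
  next
    case (Cons a us)
    then show ?thesis using False z m m' by (cases a) (auto simp: add.assoc)
  qed
qed

lemma expsum_fp_mult:
  "[expsum i (fp_mult N xs ys) = expsum i xs + expsum i ys] (mod N i)"
proof (induction xs)
  case (Cons x xs)
  obtain j k where x: "x = (j, k)" by (cases x)
  let ?k = "if j = i then k else 0"
  have "[expsum i (fp_mult N (x # xs) ys) = ?k + expsum i (fp_mult N xs ys)] (mod N i)"
    using expsum_fp_cons x by (simp del: fp_cons.simps)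
  also have "[?k + expsum i (fp_mult N xs ys) = ?k + (expsum i xs + expsum i ys)] (mod N i)"
    by (intro cong_add Cons.IH cong_refl)
  finally show ?case using x by (simp only: expsum_simps add.assoc)
qed simp

text \<open>The words whose exponent sum is divisible by the gcd form a normal subgroup. It contains
  \<open>w\<close>, hence also the generator \<open>[(i, 1)]\<close>, whose sum is 1.\<close>

lemma expsum_coprime:
  assumes gen: "normally_generates (free_prod3 r s t) w" and i: "i < 3" "ord3 r s t i > 1"
  shows "coprime (expsum i w) (ord3 r s t i)"
proof -
  let ?G = "free_prod3 r s t" and ?N = "ord3 r s t" and ?n = "ord3 r s t i"
  let ?d = "gcd (expsum i w) ?n"
  interpret group ?G by (rule group_free_prod3)
  have *: "?d dvd expsum i (fp_mult ?N x y) \<longleftrightarrow> ?d dvd expsum i x + expsum i y" for x y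
    by (rule cong_dvd_iff[OF cong_dvd_modulus_nat[OF expsum_fp_mult gcd_dvd2]])
  have inv_sum: "?d dvd expsum i x + expsum i (inv\<^bsub>?G\<^esub> x)" if "x \<in> carrier ?G" for x
    using *[of x "inv\<^bsub>?G\<^esub> x"] r_inv[OF that] by simp
  have "?d dvd expsum i [(i, 1)]"
  proof (rule normally_generates_induct[OF group_free_prod3 gen])
    fix x y assume xy: "x \<in> carrier ?G" "y \<in> carrier ?G" "?d dvd expsum i y"
    have "[expsum i (fp_mult ?N x y) + expsum i (inv\<^bsub>?G\<^esub> x) =
            (expsum i x + expsum i y) + expsum i (inv\<^bsub>?G\<^esub> x)] (mod ?d)"
      by (intro cong_add cong_dvd_modulus_nat[OF expsum_fp_mult] cong_refl gcd_dvd2)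
    then have "?d dvd expsum i (fp_mult ?N x y) + expsum i (inv\<^bsub>?G\<^esub> x)
            \<longleftrightarrow> ?d dvd (expsum i x + expsum i y) + expsum i (inv\<^bsub>?G\<^esub> x)"
      by (rule cong_dvd_iff)
    moreover have "?d dvd (expsum i x + expsum i (inv\<^bsub>?G\<^esub> x)) + expsum i y"
      by (rule dvd_add[OF inv_sum[OF xy(1)] xy(3)])
    moreover have "expsum i x + expsum i y + expsum i (inv\<^bsub>?G\<^esub> x) =
        (expsum i x + expsum i (inv\<^bsub>?G\<^esub> x)) + expsum i y"
      by simp
    ultimately show "?d dvd expsum i (x \<otimes>\<^bsub>?G\<^esub> y \<otimes>\<^bsub>?G\<^esub> inv\<^bsub>?G\<^esub> x)"
      by (simp only: * free_prod3_simps)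
  next
    fix x assume "x \<in> carrier ?G" "?d dvd expsum i x"
    then show "?d dvd expsum i (inv\<^bsub>?G\<^esub> x)" using inv_sum dvd_add_right_iff by blast
  qed (use i * in \<open>auto simp: fp_words_Cons\<close>)
  then show ?thesis by (simp add: coprime_iff_gcd_eq_1)
qed

section \<open>Quaternions over a hermitian plane\<close>

locale hermitian_plane =
  fixes cnj :: "'c::comm_ring_1 \<Rightarrow> 'c" and D E \<omega> :: 'c
  assumes cnj_add: "cnj (a + b) = cnj a + cnj b"
    and cnj_mult: "cnj (a * b) = cnj a * cnj b"
    and cnj_cnj [simp]: "cnj (cnj a) = a"
    and cnj_D [simp]: "cnj D = D" and cnj_E [simp]: "cnj E = E"
begin

lemma cnj_0 [simp]: "cnj 0 = 0"
  using cnj_add[of 0 0] by simp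

lemma cnj_1 [simp]: "cnj 1 = 1"
  using cnj_mult[of 1 "cnj 1"] by simp

lemma cnj_minus: "cnj (- a) = - cnj a"
  using cnj_add[of a "- a"] by (simp add: minus_unique)

lemma cnj_diff: "cnj (a - b) = cnj a - cnj b"
  using cnj_add[of a "- b"] by (simp add: cnj_minus)

lemmas cnj_simps = cnj_add cnj_mult cnj_minus cnj_diff

fun row1 :: "'c \<times> 'c \<times> 'c \<Rightarrow> 'c" where "row1 (a, p, q) = p * D + q * cnj \<omega>"
fun row2 :: "'c \<times> 'c \<times> 'c \<Rightarrow> 'c" where "row2 (a, p, q) = p * \<omega> + q * E"

lemma row_scalar [simp]: "row1 (a, 0, 0) = 0" "row2 (a, 0, 0) = 0"
  by simp_all

text \<open>This is \<open>(a + z j) (b + z' j) = a b - z cnj z' + (a z' + z cnj b) j\<close>, from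
  \<open>j^2 = -1\<close> and \<open>j b = cnj b j\<close>. Here \<open>z\<close> and
  \<open>z'\<close> have coordinates \<open>(p, q)\<close> and \<open>(r, s)\<close> in two vectors
  with Gram entries \<open>D\<close>, \<open>\<omega>\<close>, \<open>E\<close>, and the rows pair
  \<open>z\<close> with these vectors.\<close>

fun qmul :: "'c \<times> 'c \<times> 'c \<Rightarrow> 'c \<times> 'c \<times> 'c \<Rightarrow> 'c \<times> 'c \<times> 'c" where
  "qmul (a, p, q) (b, r, s) =
     (a * b - (row1 (a, p, q) * cnj r + row2 (a, p, q) * cnj s),
      a * r + p * cnj b, a * s + q * cnj b)"

fun qneg :: "'c \<times> 'c \<times> 'c \<Rightarrow> 'c \<times> 'c \<times> 'c" where
  "qneg (a, p, q) = (- a, - p, - q)"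

definition qone :: "'c \<times> 'c \<times> 'c" where "qone = (1, 0, 0)"

fun qpow :: "'c \<times> 'c \<times> 'c \<Rightarrow> nat \<Rightarrow> 'c \<times> 'c \<times> 'c" where
  "qpow X 0 = qone"
| "qpow X (Suc n) = qmul X (qpow X n)"

lemma qmul_one [simp]: "qmul qone X = X" "qmul X qone = X"
  by (cases X; simp add: qone_def)+

lemma qneg_simps [simp]:
  "qneg (qneg X) = X"
  "qmul (qneg X) Y = qneg (qmul X Y)"
  "qmul X (qneg Y) = qneg (qmul X Y)"
  "fst (qneg X) = - fst X" "row1 (qneg X) = - row1 X" "row2 (qneg X) = - row2 X"
  by (cases X; cases Y; simp add: algebra_simps cnj_simps)+

lemma fst_qmul: "fst (qmul X Y) =
    fst X * fst Y - (row1 X * cnj (fst (snd Y)) + row2 X * cnj (snd (snd Y)))"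
  by (cases X; cases Y) simp

text \<open>By hermitian symmetry of the pairing, the rows of the right factor may replace its
  coordinates. Together with \<open>fst_qmul\<close> this makes \<open>rel\<close> compatible with
  products on both sides.\<close>

lemma fst_qmul': "fst (qmul X Y) =
    fst X * fst Y - (fst (snd X) * cnj (row1 Y) + snd (snd X) * cnj (row2 Y))"
  by (cases X; cases Y) (simp add: algebra_simps cnj_simps)

lemma row_qmul:
  "row1 (qmul X Y) = fst X * row1 Y + cnj (fst Y) * row1 X"
  "row2 (qmul X Y) = fst X * row2 Y + cnj (fst Y) * row2 X"
  by (cases X; cases Y; simp add: algebra_simps)+

text \<open>Cayley--Hamilton for a quaternion of trace \<open>2m\<close> and norm one, iterated.\<close>

lemma qpow_Pch:
  assumes "a + cnj a = 2 * m"
    and "a * cnj a + (row1 (a, p, q) * cnj p + row2 (a, p, q) * cnj q) = 1"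
    and c: "\<And>n. cnj (poly (Pch n) m) = poly (Pch n) m"
  shows "qpow (a, p, q) (Suc n) =
    (poly (Pch (Suc n)) m * a - poly (Pch n) m, poly (Pch (Suc n)) m * p, poly (Pch (Suc n)) m * q)"
proof (induction n)
  case 0
  then show ?case by (simp add: qone_def)
next
  case (Suc n)
  define F where "F = row1 (a, p, q) * cnj p + row2 (a, p, q) * cnj q"
  have a: "cnj a = 2 * m - a" using assms(1) by (simp add: algebra_simps)
  have F: "F = 1 - a * (2 * m - a)" using assms(2) a by (simp add: F_def algebra_simps)
  define x y where "x = poly (Pch (Suc n)) m" and "y = poly (Pch n) m"
  have xy: "cnj x = x" "cnj y = y" by (simp_all add: c x_def y_def del: Pch.simps)
  have step: "poly (Pch (Suc (Suc n))) m = 2 * m * x - y" by (simp add: x_def y_def)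
  have "qpow (a, p, q) (Suc (Suc n)) = qmul (a, p, q) (x * a - y, x * p, x * q)"
    by (subst qpow.simps) (simp only: Suc.IH x_def y_def)
  also have "\<dots> = (a * (x * a - y) - x * F, a * (x * p) + p * (x * cnj a - y), a * (x * q) + q * (x * cnj a - y))"
    using xy by (simp add: cnj_simps F_def algebra_simps)
  also have "\<dots> = ((2 * m * x - y) * a - x, (2 * m * x - y) * p, (2 * m * x - y) * q)"
    unfolding F a by (simp add: algebra_simps)
  finally show ?case unfolding step by (simp only: x_def)
qed

end

text \<open>As a quadratic in \<open>y\<close>, the form \<open>x^2 - 2 m x y + y^2\<close> is
  unchanged under \<open>y\<close> to \<open>2 m x - y\<close>, which is the step of the recurrence.
  Its initial value is 1.\<close>

lemma Pch_consecutive: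
  "poly (Pch (Suc n)) m ^ 2 - 2 * m * poly (Pch (Suc n)) m * poly (Pch n) m + poly (Pch n) m ^ 2 = 1"
proof (induction n)
  case (Suc n)
  then show ?case by (simp add: algebra_simps power2_eq_square)
qed simp

text \<open>At a root the invariant form reduces to a single square. With \<open>qpow_Pch\<close>
  this makes the corresponding power of a quaternion equal to 1 or -1.\<close>

lemma Pch_root_neighbour:
  fixes m :: "'a::idom"
  assumes "poly (Pch (Suc n)) m = 0"
  shows "poly (Pch n) m = 1 \<or> poly (Pch n) m = - 1"
  using Pch_consecutive[of n m] assms by (simp add: power2_eq_1_iff del: Pch.simps)

lemma Pch_one: "poly (Pch n) (1 :: 'a::comm_ring_1) = of_nat n"
  by (induction n rule: Pch.induct) (auto simp: algebra_simps)

lemma Pch_minus: "poly (Pch n) (- m :: 'a::comm_ring_1) = (- 1) ^ Suc n * poly (Pch n) m"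
  by (induction n rule: Pch.induct) (auto simp: algebra_simps)

text \<open>Otherwise \<open>m\<close> is 1 or -1, where \<open>Pch n\<close> takes the value
  \<open>n\<close> up to sign, nonzero in characteristic 0.\<close>

lemma Pch_root_sin_nonzero:
  fixes m s :: "'a::field_char_0"
  assumes "poly (Pch n) m = 0" "n > 0" "s^2 + m^2 = 1"
  shows "s \<noteq> 0"
proof
  assume "s = 0"
  then have "m = 1 \<or> m = - 1" using assms(3) by (simp add: power2_eq_1_iff)
  then show False using assms(1,2) Pch_one[of n, where ?'a = 'a] Pch_minus[of n "1 :: 'a"] by auto
qed

section \<open>Congruence modulo a conjugation-stable ideal containing the Gram determinant\<close>

locale hermitian_plane_ideal = hermitian_plane +
  fixes I :: "'a set"
  assumes zero_I: "0 \<in> I" and add_I: "a \<in> I \<Longrightarrow> b \<in> I \<Longrightarrow> a + b \<in> I"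
    and mult_I: "a \<in> I \<Longrightarrow> b * a \<in> I" and cnj_I: "a \<in> I \<Longrightarrow> cnj a \<in> I"
    and det_I: "D * E - \<omega> * cnj \<omega> \<in> I"
begin

definition cg :: "'a \<Rightarrow> 'a \<Rightarrow> bool" (infix "\<simeq>" 50) where
  "a \<simeq> b \<longleftrightarrow> a - b \<in> I"

lemma minus_I: "a \<in> I \<Longrightarrow> - a \<in> I"
  using mult_I[of a "- 1"] by simp

lemma cg_refl [simp]: "a \<simeq> a"
  by (simp add: cg_def zero_I)

lemma cg_sym: "a \<simeq> b \<Longrightarrow> b \<simeq> a"
  using minus_I[of "a - b"] by (simp add: cg_def)

lemma cg_trans [trans]: "a \<simeq> b \<Longrightarrow> b \<simeq> c \<Longrightarrow> a \<simeq> c"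
  using add_I[of "a - b" "b - c"] by (simp add: cg_def)

lemma cg_add: "a \<simeq> b \<Longrightarrow> c \<simeq> d \<Longrightarrow> a + c \<simeq> b + d"
  using add_I[of "a - b" "c - d"] by (simp add: cg_def algebra_simps)

lemma cg_minus: "a \<simeq> b \<Longrightarrow> - a \<simeq> - b"
  using minus_I[of "a - b"] by (simp add: cg_def)

lemma cg_diff: "a \<simeq> b \<Longrightarrow> c \<simeq> d \<Longrightarrow> a - c \<simeq> b - d"
  using cg_add[of a b "- c" "- d"] cg_minus by simp

lemma cg_mult: "a \<simeq> b \<Longrightarrow> c \<simeq> d \<Longrightarrow> a * c \<simeq> b * d"
  using add_I[OF mult_I[of "a - b" c] mult_I[of "c - d" b]] by (simp add: cg_def algebra_simps)

lemma cg_cnj: "a \<simeq> b \<Longrightarrow> cnj a \<simeq> cnj b"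
  using cnj_I[of "a - b"] by (simp add: cg_def cnj_simps)

lemma cg_0_mult: "a \<simeq> 0 \<Longrightarrow> b * a \<simeq> 0"
  by (simp add: cg_def mult_I)

text \<open>The pair \<open>(p, q)\<close> stands for \<open>p z\<^sub>2 + q z\<^sub>3\<close> with \<open>z\<^sub>2, z\<^sub>3\<close> the components of the second
  and third rotation axis orthogonal to the first, and \<open>D, \<omega>, E\<close> are the products
  \<open>z\<^sub>2 cnj z\<^sub>2, z\<^sub>2 cnj z\<^sub>3, z\<^sub>3 cnj z\<^sub>3\<close>. Such a combination is only observed through its products with
  \<open>cnj z\<^sub>2\<close> and \<open>cnj z\<^sub>3\<close>; multiplication is associative only after this identification.\<close>

definition rel :: "'a \<times> 'a \<times> 'a \<Rightarrow> 'a \<times> 'a \<times> 'a \<Rightarrow> bool" where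
  "rel X Y \<longleftrightarrow> fst X \<simeq> fst Y \<and> row1 X \<simeq> row1 Y \<and> row2 X \<simeq> row2 Y"

lemma rel_refl [simp]: "rel X X"
  by (simp add: rel_def)

lemma rel_sym: "rel X Y \<Longrightarrow> rel Y X"
  by (auto simp: rel_def intro: cg_sym)

lemma rel_trans [trans]: "rel X Y \<Longrightarrow> rel Y Z \<Longrightarrow> rel X Z"
  unfolding rel_def by (meson cg_trans)

lemma rel_qneg: "rel X Y \<Longrightarrow> rel (qneg X) (qneg Y)"
  by (simp add: rel_def cg_minus)

lemma rel_qmul:
  assumes "rel X X'" "rel Y Y'"
  shows "rel (qmul X Y) (qmul X' Y')"
proof -
  have "fst (qmul X Y) \<simeq> fst (qmul X' Y)"
    unfolding fst_qmul using assms(1) by (intro cg_diff cg_mult cg_add) (auto simp: rel_def)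
  also have "\<dots> \<simeq> fst (qmul X' Y')"
    unfolding fst_qmul' using assms(2) by (intro cg_diff cg_mult cg_add cg_cnj) (auto simp: rel_def)
  finally show ?thesis
    unfolding rel_def row_qmul using assms
    by (auto simp: rel_def intro!: cg_add cg_mult cg_cnj)
qed

text \<open>The first components agree exactly. The rows differ by multiples of the Gram determinant
  \<open>D * E - \<omega> * cnj \<omega>\<close>, which lies in \<open>I\<close>.\<close>

lemma qmul_assoc: "rel (qmul (qmul X Y) Z) (qmul X (qmul Y Z))"
proof -
  obtain a p q b r s c t w where [simp]: "X = (a, p, q)" "Y = (b, r, s)" "Z = (c, t, w)"
    by (cases X; cases Y; cases Z)
  let ?d = "D * E - \<omega> * cnj \<omega>"
  have "fst (qmul (qmul X Y) Z) = fst (qmul X (qmul Y Z))"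
    by (simp add: algebra_simps cnj_simps)
  moreover have "row1 (qmul (qmul X Y) Z) - row1 (qmul X (qmul Y Z)) = (p * w - q * t) * cnj s * ?d"
    by (simp add: algebra_simps cnj_simps)
  moreover have "row2 (qmul (qmul X Y) Z) - row2 (qmul X (qmul Y Z)) = - (p * w - q * t) * cnj r * ?d"
    by (simp add: algebra_simps cnj_simps)
  ultimately show ?thesis
    unfolding rel_def cg_def using mult_I[OF det_I] zero_I by (simp del: qmul.simps)
qed

text \<open>The relations of the cyclic factors hold only up to sign, so the representation is
  projective and its values are compared up to sign.\<close>

definition near :: "'a \<times> 'a \<times> 'a \<Rightarrow> 'a \<times> 'a \<times> 'a \<Rightarrow> bool" (infix "\<approx>" 50) where
  "X \<approx> Y \<longleftrightarrow> rel X Y \<or> rel X (qneg Y)"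

lemma rel_near: "rel X Y \<Longrightarrow> X \<approx> Y"
  by (simp add: near_def)

lemma near_refl [simp]: "X \<approx> X"
  by (simp add: near_def)

lemma near_sym: "X \<approx> Y \<Longrightarrow> Y \<approx> X"
  unfolding near_def using rel_sym[of X Y] rel_sym[OF rel_qneg[of X "qneg Y"]] qneg_simps(1)[of Y] by metis

lemma near_trans [trans]: "X \<approx> Y \<Longrightarrow> Y \<approx> Z \<Longrightarrow> X \<approx> Z"
  unfolding near_def using rel_trans[of X Y Z] rel_trans[of X Y "qneg Z"] rel_trans[of X "qneg Y" Z]
    rel_trans[of X "qneg Y" "qneg Z"] rel_qneg[of Y Z] rel_qneg[of Y "qneg Z"] qneg_simps(1)[of Z] by metis

lemma near_qmul:
  assumes "X \<approx> X'" "Y \<approx> Y'"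
  shows "qmul X Y \<approx> qmul X' Y'"
proof -
  have "rel (qmul X Y) (qmul X' Y') \<or> rel (qmul X Y) (qmul (qneg X') Y') \<or>
    rel (qmul X Y) (qmul X' (qneg Y')) \<or> rel (qmul X Y) (qmul (qneg X') (qneg Y'))"
    using assms rel_qmul unfolding near_def by blast
  then show ?thesis by (auto simp: near_def)
qed

lemma near_assoc: "qmul (qmul X Y) Z \<approx> qmul X (qmul Y Z)"
  by (rule rel_near[OF qmul_assoc])

lemma near_qpow_one: "X \<approx> qone \<Longrightarrow> qpow X n \<approx> qone"
proof (induction n)
  case (Suc n)
  then show ?case using near_qmul[of X qone "qpow X n" qone] by simp
qed simp

lemma qpow_add: "qpow X (m + n) \<approx> qmul (qpow X m) (qpow X n)"
proof (induction m)
  case (Suc m)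
  have "qpow X (Suc m + n) \<approx> qmul X (qmul (qpow X m) (qpow X n))"
    using near_qmul[OF near_refl Suc] by simp
  also have "\<dots> \<approx> qmul (qpow X (Suc m)) (qpow X n)"
    using near_sym[OF near_assoc] by simp
  finally show ?case .
qed simp

lemma qpow_mult: "qpow X (m * n) \<approx> qpow (qpow X m) n"
proof (induction n)
  case (Suc n)
  have "qpow X (m * Suc n) \<approx> qmul (qpow X m) (qpow X (m * n))"
    using qpow_add by simp
  also have "\<dots> \<approx> qpow (qpow X m) (Suc n)" using near_qmul[OF near_refl Suc] by simp
  finally show ?case .
qed simp

lemma qpow_mod: "qpow X n \<approx> qone \<Longrightarrow> qpow X (k mod n) \<approx> qpow X k"
proof -
  assume n: "qpow X n \<approx> qone"
  have "qpow X k \<approx> qmul (qpow X (n * (k div n))) (qpow X (k mod n))"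
    using qpow_add[of X "n * (k div n)" "k mod n"] by simp
  also have "\<dots> \<approx> qmul qone (qpow X (k mod n))"
    by (intro near_qmul near_refl near_trans[OF qpow_mult near_qpow_one[OF n]])
  finally show ?thesis using near_sym by simp
qed

section \<open>Quaternions that are scalar modulo the ideal\<close>

definition scalar :: "'a \<times> 'a \<times> 'a \<Rightarrow> bool" where
  "scalar X \<longleftrightarrow> fst X \<simeq> cnj (fst X) \<and> row1 X \<simeq> 0 \<and> row2 X \<simeq> 0"

lemma scalar_qone: "scalar qone"
  by (simp add: scalar_def qone_def)

lemma scalar_near:
  assumes "X \<approx> Y" "scalar Y"
  shows "scalar X"
proof -
  have rel: "scalar X" if "rel X Y" "scalar Y" for X Y
    using that unfolding scalar_def rel_def by (meson cg_cnj cg_sym cg_trans)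
  have "scalar (qneg Y)" if "scalar Y" for Y
    using that cg_minus[of "row1 Y" 0] cg_minus[of "row2 Y" 0] by (simp add: scalar_def cnj_minus cg_minus)
  with rel assms show ?thesis unfolding near_def by blast
qed

lemma scalar_rel: "scalar X \<Longrightarrow> rel X (fst X, 0, 0)"
  by (simp add: scalar_def rel_def)

lemma scalar_qmul:
  assumes "scalar X" "scalar Y"
  shows "scalar (qmul X Y)"
proof -
  have "fst (qmul X Y) \<simeq> fst X * fst Y"
    using rel_qmul[OF scalar_rel[OF assms(1)] rel_refl[of Y]] by (cases Y) (simp add: rel_def)
  also have "fst X * fst Y \<simeq> cnj (fst X * fst Y)"
    using assms unfolding cnj_mult by (intro cg_mult) (auto simp: scalar_def)
  also have "\<dots> \<simeq> cnj (fst (qmul X Y))"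
    using cg_cnj[OF cg_sym[OF \<open>fst (qmul X Y) \<simeq> _\<close>]] .
  finally show ?thesis
    using assms cg_add[OF cg_0_mult cg_0_mult] by (auto simp: scalar_def row_qmul)
qed

lemma scalar_qpow: "scalar X \<Longrightarrow> scalar (qpow X n)"
  by (induction n) (auto intro: scalar_qmul scalar_qone)

text \<open>A scalar is central modulo \<open>I\<close>: moving it past \<open>Y\<close> replaces
  its first component by the conjugate, which is congruent to it. Then \<open>Y\<close> and
  \<open>Z\<close> cancel.\<close>

lemma scalar_conjugate:
  assumes "scalar X" "qmul Y Z \<approx> qone"
  shows "scalar (qmul (qmul Y X) Z)"
proof -
  have "rel (qmul Y X) (qmul X Y)"
  proof (rule rel_trans[OF rel_qmul[OF rel_refl scalar_rel[OF assms(1)]]],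
      rule rel_trans[OF _ rel_qmul[OF rel_sym[OF scalar_rel[OF assms(1)]] rel_refl]])
    have "cnj (fst X) \<simeq> fst X" using assms(1) cg_sym by (simp add: scalar_def)
    then show "rel (qmul Y (fst X, 0, 0)) (qmul (fst X, 0, 0) Y)"
      by (cases Y) (auto simp: rel_def row_qmul fst_qmul mult.commute simp del: row1.simps row2.simps qmul.simps
            intro!: cg_mult)
  qed
  then have "qmul (qmul Y X) Z \<approx> qmul (qmul X Y) Z"
    by (intro near_qmul rel_near near_refl)
  also have "\<dots> \<approx> qmul X (qmul Y Z)" by (rule near_assoc)
  also have "\<dots> \<approx> qmul X qone" by (intro near_qmul near_refl assms)
  finally show ?thesis using scalar_near assms(1) by simp
qed

text \<open>The product of the first components is 1 or -1 modulo \<open>I\<close>, so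
  \<open>fst X\<close> is a unit modulo \<open>I\<close> and can be cancelled from each defining
  congruence.\<close>

lemma scalar_inverse:
  assumes X: "scalar X" and "qmul X Y \<approx> qone"
  shows "scalar Y"
proof -
  let ?a = "fst X"
  have "qmul (?a, 0, 0) Y \<approx> qone"
    using near_trans[OF near_qmul[OF rel_near[OF rel_sym[OF scalar_rel[OF X]]] near_refl] assms(2)] .
  then obtain e where e: "e * e = 1" "cnj e = e" "rel (qmul (?a, 0, 0) Y) (e, 0, 0)"
    using that[of 1] that[of "- 1"] by (auto simp: near_def qone_def cnj_minus)
  let ?b = "fst Y"
  have ab: "?a * ?b \<simeq> e" and r: "?a * row1 Y \<simeq> 0" "?a * row2 Y \<simeq> 0"
    using e(3) unfolding rel_def row_qmul fst_qmul by simp_all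
  \<comment> \<open>Multiplication by \<open>e * ?b\<close>, an inverse of \<open>?a\<close> modulo
    \<open>I\<close>.\<close>
  have unit: "x \<simeq> 0" if "?a * x \<simeq> 0" for x
  proof -
    have "(e * e) * x \<simeq> e * ((?a * ?b) * x)"
      unfolding mult.assoc by (intro cg_mult[OF cg_refl] ) 
        (use cg_mult[OF cg_sym[OF ab] cg_refl] in \<open>simp add: mult.assoc\<close>)
    also have "\<dots> = (e * ?b) * (?a * x)" by (simp add: algebra_simps)
    also have "\<dots> \<simeq> 0" by (rule cg_0_mult[OF that])
    finally show ?thesis by (simp add: e)
  qed
  have "?a * cnj ?b \<simeq> cnj ?a * cnj ?b" using X by (intro cg_mult) (auto simp: scalar_def)
  also have "\<dots> \<simeq> e" using cg_cnj[OF ab] by (simp add: cnj_mult e)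
  finally have "?a * ?b - ?a * cnj ?b \<simeq> e - e" using ab cg_diff by blast
  then have "?a * (?b - cnj ?b) \<simeq> 0" by (simp add: algebra_simps)
  then have "?b - cnj ?b \<simeq> 0" by (rule unit)
  then show ?thesis unfolding scalar_def using unit r by (simp add: cg_def)
qed

end

section \<open>Adjoining a square root of minus one\<close>

text \<open>The square root is adjoined formally, so that conjugation is defined even if -1 is
  already a square in the base ring.\<close>

datatype 'b gauss = Gauss (gre: 'b) (gim: 'b)

instantiation gauss :: (comm_ring_1) comm_ring_1
begin

definition "0 = Gauss 0 0"
definition "1 = Gauss 1 0"
definition "x + y = Gauss (gre x + gre y) (gim x + gim y)"
definition "x - y = Gauss (gre x - gre y) (gim x - gim y)"
definition "- x = Gauss (- gre x) (- gim x)"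
definition "x * y = Gauss (gre x * gre y - gim x * gim y) (gre x * gim y + gim x * gre y)"

lemmas gauss_defs = zero_gauss_def one_gauss_def plus_gauss_def minus_gauss_def uminus_gauss_def
  times_gauss_def

instance
  by standard (auto simp: gauss_defs algebra_simps)

end

lemma gauss_sel [simp]:
  "gre (0 :: 'b::comm_ring_1 gauss) = 0" "gim (0 :: 'b gauss) = 0"
  "gre (1 :: 'b gauss) = 1" "gim (1 :: 'b gauss) = 0"
  "gre (x + y :: 'b gauss) = gre x + gre y" "gim (x + y) = gim x + gim y"
  "gre (x - y) = gre x - gre y" "gim (x - y) = gim x - gim y"
  "gre (- x) = - gre x" "gim (- x) = - gim x"
  "gre (x * y) = gre x * gre y - gim x * gim y" "gim (x * y) = gre x * gim y + gim x * gre y"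
  by (simp_all add: gauss_defs)

lemma gauss_two [simp]: "gre (2 :: 'b::comm_ring_1 gauss) = 2" "gim (2 :: 'b gauss) = 0"
  using gauss_sel(5,6)[of 1 1] by simp_all

definition gcnj :: "'b::comm_ring_1 gauss \<Rightarrow> 'b gauss" where
  "gcnj z = Gauss (gre z) (- gim z)"

lemma gcnj_sel [simp]: "gre (gcnj z) = gre z" "gim (gcnj z) = - gim z"
  by (simp_all add: gcnj_def)

definition greal :: "'b::comm_ring_1 \<Rightarrow> 'b gauss" where
  "greal a = Gauss a 0"

lemma greal_sel [simp]: "gre (greal a) = a" "gim (greal a) = 0"
  by (simp_all add: greal_def)

text \<open>\<open>Pch n\<close> has integer coefficients, so evaluating it commutes with ring
  homomorphisms.\<close>

lemma poly_Pch_hom: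
  fixes h :: "'a::comm_ring_1 \<Rightarrow> 'b::comm_ring_1"
  assumes h: "h 0 = 0" "h 1 = 1" "\<And>a b. h (a * b) = h a * h b" "\<And>a b. h (a - b) = h a - h b"
    "\<And>a b. h (a + b) = h a + h b"
  shows "poly (Pch n) (h m) = h (poly (Pch n) m)"
proof (induction n rule: Pch.induct)
  case (3 n)
  have "h 2 = 2" using h(5)[of 1 1] by (simp add: h(2))
  with 3 show ?case by (simp add: h(3,4))
qed (simp_all add: h(1,2))

section \<open>Evaluating words of the free product\<close>

context hermitian_plane
begin

definition word_val :: "(nat \<Rightarrow> 'c \<times> 'c \<times> 'c) \<Rightarrow> (nat \<times> nat) list \<Rightarrow> 'c \<times> 'c \<times> 'c" where
  "word_val Q ws = foldr (\<lambda>(i, k). qmul (qpow (Q i) k)) ws qone"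

lemma word_val_simps [simp]:
  "word_val Q [] = qone"
  "word_val Q ((i, k) # ws) = qmul (qpow (Q i) k) (word_val Q ws)"
  by (simp_all add: word_val_def)

end

context hermitian_plane_ideal
begin

text \<open>Reducing an exponent modulo \<open>N i\<close>, or dropping a syllable that becomes
  trivial, changes the value only by a power of \<open>qpow (Q i) (N i)\<close>, that is, by a sign
  modulo \<open>I\<close>.\<close>

lemma word_val_fp_cons:
  assumes Q: "\<And>i. qpow (Q i) (N i) \<approx> qone"
  shows "word_val Q (fp_cons N (i, k) ws) \<approx> qmul (qpow (Q i) k) (word_val Q ws)"
proof -
  have mod: "qmul (qpow (Q i) (m mod N i)) X \<approx> qmul (qpow (Q i) m) X" for m X
    by (intro near_qmul near_refl qpow_mod Q)
  have mod0: "X \<approx> qmul (qpow (Q i) m) X" if "m mod N i = 0" for m X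
    using mod[of m X] that by simp
  show ?thesis
  proof (cases "k mod N i = 0")
    case True
    then show ?thesis using mod0 by simp
  next
    case k: False
    show ?thesis
    proof (cases "\<exists>l us. ws = (i, l) # us")
      case True
      then obtain l us where ws: "ws = (i, l) # us" by blast
      have "word_val Q (fp_cons N (i, k) ws) \<approx> qmul (qpow (Q i) (k + l)) (word_val Q us)"
        using k ws mod0[of "k + l"] mod[of "k + l"] by simp
      also have "\<dots> \<approx> qmul (qmul (qpow (Q i) k) (qpow (Q i) l)) (word_val Q us)"
        by (intro near_qmul qpow_add near_refl)
      also have "\<dots> \<approx> qmul (qpow (Q i) k) (word_val Q ws)"
        unfolding ws word_val_simps by (rule near_assoc)
      finally show ?thesis .
    next
      case False
      then have "fp_cons N (i, k) ws = (i, k mod N i) # ws" using k by (cases ws) auto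
      then show ?thesis using mod by simp
    qed
  qed
qed

lemma word_val_fp_mult:
  assumes Q: "\<And>i. qpow (Q i) (N i) \<approx> qone"
  shows "word_val Q (fp_mult N xs ys) \<approx> qmul (word_val Q xs) (word_val Q ys)"
proof (induction xs)
  case (Cons x xs)
  obtain i k where x: "x = (i, k)" by (cases x)
  have "word_val Q (fp_mult N (x # xs) ys) \<approx> qmul (qpow (Q i) k) (word_val Q (fp_mult N xs ys))"
    using word_val_fp_cons[OF Q] x by (simp del: fp_cons.simps)
  also have "\<dots> \<approx> qmul (qpow (Q i) k) (qmul (word_val Q xs) (word_val Q ys))"
    by (intro near_qmul near_refl Cons.IH)
  also have "\<dots> \<approx> qmul (word_val Q (x # xs)) (word_val Q ys)"
    unfolding x word_val_simps by (rule near_sym[OF near_assoc])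
  finally show ?case .
qed simp

text \<open>Elements with scalar image are closed under products, inverses and conjugation, so
  \<open>normally_generates_induct\<close> applies.\<close>

lemma scalar_word_val:
  assumes gen: "normally_generates (free_prod3 r s t) w"
    and Q: "\<And>i. qpow (Q i) (ord3 r s t i) \<approx> qone"
    and w: "scalar (word_val Q w)"
    and g: "g \<in> carrier (free_prod3 r s t)"
  shows "scalar (word_val Q g)"
proof -
  let ?G = "free_prod3 r s t"
  interpret group ?G by (rule group_free_prod3)
  have mult: "word_val Q (x \<otimes>\<^bsub>?G\<^esub> y) \<approx> qmul (word_val Q x) (word_val Q y)" for x y
    using word_val_fp_mult[OF Q] by simp
  have inverse: "qmul (word_val Q x) (word_val Q (inv\<^bsub>?G\<^esub> x)) \<approx> qone" if "x \<in> carrier ?G" for x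
    using near_sym[OF mult[of x "inv\<^bsub>?G\<^esub> x"]] r_inv[OF that] by simp
  show ?thesis
  proof (rule normally_generates_induct[OF group_free_prod3 gen _ _ _ _ _ g])
    fix x y assume "x \<in> carrier ?G" "y \<in> carrier ?G" "scalar (word_val Q y)"
    then have "scalar (qmul (qmul (word_val Q x) (word_val Q y)) (word_val Q (inv\<^bsub>?G\<^esub> x)))"
      by (intro scalar_conjugate inverse)
    moreover have "word_val Q (x \<otimes>\<^bsub>?G\<^esub> y \<otimes>\<^bsub>?G\<^esub> inv\<^bsub>?G\<^esub> x) \<approx>
        qmul (qmul (word_val Q x) (word_val Q y)) (word_val Q (inv\<^bsub>?G\<^esub> x))"
      by (rule near_trans[OF mult near_qmul[OF mult near_refl]])
    ultimately show "scalar (word_val Q (x \<otimes>\<^bsub>?G\<^esub> y \<otimes>\<^bsub>?G\<^esub> inv\<^bsub>?G\<^esub> x))"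
      using scalar_near by blast
  next
    fix x y assume "scalar (word_val Q x)" "scalar (word_val Q y)"
    then show "scalar (word_val Q (x \<otimes>\<^bsub>?G\<^esub> y))" by (rule scalar_near[OF mult scalar_qmul])
  next
    fix x assume "x \<in> carrier ?G" "scalar (word_val Q x)"
    then show "scalar (word_val Q (inv\<^bsub>?G\<^esub> x))" using scalar_inverse inverse by blast
  qed (simp_all add: w scalar_qone)
qed

section \<open>Replacing the generating quaternions by powers\<close>

lemma qpow_qpow_one:
  assumes "qpow X n \<approx> qone"
  shows "qpow (qpow X f) n \<approx> qone"
proof -
  have "qpow (qpow X f) n \<approx> qpow X (n * f)"
    using near_sym[OF qpow_mult[of X f n]] by (simp add: mult.commute)
  also have "\<dots> \<approx> qone" by (rule near_trans[OF qpow_mult near_qpow_one[OF assms]])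
  finally show ?thesis .
qed

lemma qpow_qpow_inverse_exponent:
  assumes "qpow X n \<approx> qone" "[e * f = 1] (mod n)" "n > 1"
  shows "qpow (qpow X f) e \<approx> X"
proof -
  have "qpow (qpow X f) e \<approx> qpow X (e * f)"
    using near_sym[OF qpow_mult[of X f e]] by (simp add: mult.commute)
  also have "\<dots> \<approx> qpow X (e * f mod n)" by (rule near_sym[OF qpow_mod[OF assms(1)]])
  also have "e * f mod n = 1" using assms(2,3) by (simp add: cong_def)
  finally show ?thesis by simp
qed

text \<open>The generator \<open>(i, 1)\<close> is sent to a power of \<open>X i\<close>, which is
  therefore scalar. Raising it to the inverse exponent \<open>e\<close> recovers \<open>X i\<close>
  up to sign.\<close>

lemma scalar_generator:
  assumes gen: "normally_generates (free_prod3 r s t) w"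
    and X: "\<And>i. qpow (X i) (ord3 r s t i) \<approx> qone"
    and w: "scalar (word_val (\<lambda>i. qpow (X i) (f i)) w)"
    and i: "i < 3" "[e * f i = 1] (mod ord3 r s t i)" "ord3 r s t i > 1"
  shows "scalar (X i)"
proof -
  have "scalar (word_val (\<lambda>i. qpow (X i) (f i)) [(i, 1)])"
    by (rule scalar_word_val[OF gen qpow_qpow_one[OF X] w]) (use i in \<open>simp add: fp_words_Cons\<close>)
  then have "scalar (qpow (X i) (f i))" by simp
  then have "scalar (qpow (qpow (X i) (f i)) e)" by (rule scalar_qpow)
  then show ?thesis
    by (rule scalar_near[OF near_sym[OF qpow_qpow_inverse_exponent[OF X i(2,3)]]])
qed

section \<open>The commutative quotient, where all orthogonal products vanish\<close>

lemma fst_qmul_commutative: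
  assumes "D \<in> I" "E \<in> I" "\<omega> \<in> I"
  shows "fst (qmul X Y) \<simeq> fst X * fst Y"
proof -
  have "row1 X \<simeq> 0" "row2 X \<simeq> 0"
    using assms by (cases X; auto simp: cg_def intro!: add_I mult_I cnj_I)+
  then have "row1 X * cnj (fst (snd Y)) + row2 X * cnj (snd (snd Y)) \<simeq> 0 + 0"
    using cg_0_mult[of "row1 X" "cnj (fst (snd Y))"] cg_0_mult[of "row2 X" "cnj (snd (snd Y))"]
    by (intro cg_add) (simp_all add: mult.commute)
  from cg_diff[OF cg_refl this] show ?thesis by (simp add: fst_qmul)
qed

lemma fst_qpow_commutative:
  assumes "D \<in> I" "E \<in> I" "\<omega> \<in> I"
  shows "fst (qpow X n) \<simeq> fst X ^ n"
proof (induction n)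
  case (Suc n)
  show ?case
    using cg_trans[OF fst_qmul_commutative[OF assms] cg_mult[OF cg_refl Suc]] by simp
qed (simp add: qone_def)

lemma fst_word_val_commutative:
  assumes I: "D \<in> I" "E \<in> I" "\<omega> \<in> I"
  shows "ws \<in> fp_words N \<Longrightarrow> fst (word_val Q ws) \<simeq> (\<Prod>i<3. fst (Q i) ^ expsum i ws)"
proof (induction ws)
  case (Cons x ws)
  obtain i k where x: "x = (i, k)" by (cases x)
  have i: "i < 3" and ws: "ws \<in> fp_words N" using Cons.prems x by (auto simp: fp_words_Cons)
  have "fst (word_val Q (x # ws)) \<simeq> fst (qpow (Q i) k) * fst (word_val Q ws)"
    unfolding x word_val_simps by (rule fst_qmul_commutative[OF I])
  also have "\<dots> \<simeq> fst (Q i) ^ k * (\<Prod>i<3. fst (Q i) ^ expsum i ws)"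
    by (intro cg_mult fst_qpow_commutative[OF I] Cons.IH[OF ws])
  \<comment> \<open>The power is written as a product over all three factors so that exponents can
    be added factor by factor.\<close>
  also have "fst (Q i) ^ k = (\<Prod>j<3. if j = i then fst (Q j) ^ k else 1)"
    using i by (simp add: prod.delta)
  also have "\<dots> * (\<Prod>i<3. fst (Q i) ^ expsum i ws) = (\<Prod>j<3. fst (Q j) ^ expsum j (x # ws))"
    unfolding prod.distrib[symmetric] x by (intro prod.cong) (auto simp: power_add)
  finally show ?case .
qed (simp add: qone_def)

text \<open>In the commutative quotient only exponent sums matter. As \<open>f i\<close> inverts the
  \<open>i\<close>-th sum modulo the order, the \<open>i\<close>-th factor becomes
  \<open>fst (X i)\<close> up to sign, as if every exponent sum were 1.\<close>

lemma fst_word_val_generators: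
  assumes I: "D \<in> I" "E \<in> I" "\<omega> \<in> I"
    and w: "w \<in> fp_words N"
    and X: "\<And>i. qpow (X i) (N i) \<approx> qone"
    and f: "\<And>i. i < 3 \<Longrightarrow> [expsum i w * f i = 1] (mod N i)" "\<And>i. N i > 1"
  shows "\<exists>e. (e = 1 \<or> e = - 1) \<and>
    fst (word_val (\<lambda>i. qpow (X i) (f i)) w) \<simeq> e * (\<Prod>i<3. fst (X i))"
proof -
  let ?Q = "\<lambda>i. qpow (X i) (f i)"
  have "\<exists>e. (e = 1 \<or> e = - 1) \<and> fst (?Q i) ^ expsum i w \<simeq> e * fst (X i)" if "i < 3" for i
  proof -
    have "qpow (?Q i) (expsum i w) \<approx> X i"
      by (rule qpow_qpow_inverse_exponent[OF X f(1)[OF that] f(2)])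
    then have "fst (qpow (?Q i) (expsum i w)) \<simeq> 1 * fst (X i) \<or>
        fst (qpow (?Q i) (expsum i w)) \<simeq> (- 1) * fst (X i)"
      by (auto simp: near_def rel_def)
    then show ?thesis using cg_trans[OF cg_sym[OF fst_qpow_commutative[OF I]]] by blast
  qed
  then obtain e where e: "\<And>i. i < 3 \<Longrightarrow> (e i = 1 \<or> e i = - 1)"
      "\<And>i. i < 3 \<Longrightarrow> fst (?Q i) ^ expsum i w \<simeq> e i * fst (X i)"
    by metis
  have "fst (word_val ?Q w) \<simeq> (\<Prod>i<3. fst (?Q i) ^ expsum i w)"
    by (rule fst_word_val_commutative[OF I w])
  also have "\<dots> \<simeq> (\<Prod>i<3. e i * fst (X i))"
    using e(2) by (auto simp: numeral_3_eq_3 intro!: cg_mult)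
  also have "\<dots> = (\<Prod>i<3. e i) * (\<Prod>i<3. fst (X i))" by (rule prod.distrib)
  finally have "fst (word_val ?Q w) \<simeq> (\<Prod>i<3. e i) * (\<Prod>i<3. fst (X i))" .
  moreover have "(\<Prod>i<3. e i) = 1 \<or> (\<Prod>i<3. e i) = - 1"
    using e(1)[of 0] e(1)[of 1] e(1)[of 2] by (auto simp: numeral_3_eq_3 numeral_2_eq_2)
  ultimately show ?thesis by blast
qed

end

lemma hermitian_plane_gauss: "hermitian_plane gcnj (greal d) (greal e)"
  by standard (auto intro!: gauss.expand)

text \<open>Extending \<open>I\<close> coordinatewise gives an ideal stable under conjugation. The
  Gram determinant is real because \<open>z * gcnj z\<close> is the sum of the squares of the
  coordinates.\<close>

lemma hermitian_plane_ideal_gauss: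
  assumes "0 \<in> I" "\<And>a b. a \<in> I \<Longrightarrow> b \<in> I \<Longrightarrow> a + b \<in> I" "\<And>a b. a \<in> I \<Longrightarrow> b * a \<in> I"
    and "d * e - (gre z ^ 2 + gim z ^ 2) \<in> I"
  shows "hermitian_plane_ideal gcnj (greal d) (greal e) z {a. gre a \<in> I \<and> gim a \<in> I}"
proof -
  interpret hermitian_plane gcnj "greal d" "greal e" by (rule hermitian_plane_gauss)
  have minus: "- a \<in> I" if "a \<in> I" for a using assms(3)[OF that, of "- 1"] by simp
  have diff: "a - b \<in> I" if "a \<in> I" "b \<in> I" for a b using assms(2)[OF that(1) minus[OF that(2)]] by simp
  show ?thesis
  proof
    show "greal d * greal e - z * gcnj z \<in> {a. gre a \<in> I \<and> gim a \<in> I}"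
      using assms(1,4) by (simp add: power2_eq_square mult.commute)
  qed (use assms(1) in \<open>auto intro: assms(2,3) minus diff\<close>)
qed

lemma C4_hom:
  "C4 0 = 0" "C4 1 = 1" "C4 (a + b) = C4 a + C4 b" "C4 (a - b) = C4 a - C4 b"
  "C4 (- a) = - C4 a" "C4 (a * b) = C4 a * C4 b"
  by (simp_all add: C4_def one_pCons)

lemma C4_power: "C4 (a ^ n) = C4 a ^ n"
  by (induction n) (simp_all add: C4_hom)


section \<open>Three rotations over the polynomial ring and the two ideals\<close>

theorem mainTheorem20:
  fixes r s t :: nat
    and \<mu>1 \<mu>2 \<mu>3 s1 s2 s3 :: "'a::field_char_0"
  assumes "r > 1" and "s > 1" and "t > 1"
    and "poly (Pch r) \<mu>1 = 0" and "poly (Pch s) \<mu>2 = 0" and "poly (Pch t) \<mu>3 = 0"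
    and "s1^2 + \<mu>1^2 = 1" and "s2^2 + \<mu>2^2 = 1" and "s3^2 + \<mu>3^2 = 1"
    and "\<forall>(q1 :: nat \<Rightarrow> 'a mpoly4) q2 c1 c2 c3 c4 f g h.
           f * bilinM q1 q2
           + g * (Wel \<mu>1 \<mu>2 \<mu>3 s1 s2 s3 + (c1 * Uv + c2 * Vv + c3 * (1 - Xv^2) + c4 * (1 - Yv^2)))
           + h * Rrel \<noteq> 1"
  shows "\<not> (\<exists>w \<in> carrier (free_prod3 r s t). normally_generates (free_prod3 r s t) w)"
proof
  assume "\<exists>w \<in> carrier (free_prod3 r s t). normally_generates (free_prod3 r s t) w"
  then obtain w where w: "w \<in> fp_words (ord3 r s t)"
    and gen: "normally_generates (free_prod3 r s t) w" by auto
  have s1: "s1 \<noteq> 0" using Pch_root_sin_nonzero[OF assms(4) _ assms(7)] assms(1) by simp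
  let ?N = "ord3 r s t"
  have N: "?N i > 1" for i using assms(1-3) by (simp add: ord3_def)
  have "\<exists>f. [expsum i w * f = 1] (mod ?N i)" if "i < 3" for i
    using cong_solve_coprime_nat[OF expsum_coprime[OF gen that N]] by simp
  then obtain f where f: "\<And>i. i < 3 \<Longrightarrow> [expsum i w * f i = 1] (mod ?N i)" by metis

  \<comment> \<open>The Gram entries of the orthogonal components of the second and third axis. With
    \<open>om\<close> representing \<open>u + i v\<close>, the Gram determinant becomes
    \<open>Rrel\<close>.\<close>
  define D E :: "'a mpoly4" where "D = 1 - Xv^2" and "E = 1 - Yv^2"
  define om :: "'a mpoly4 gauss" where "om = Gauss Uv Vv"
  interpret hermitian_plane gcnj "greal D" "greal E" om by (rule hermitian_plane_gauss)
  define mu sn where "mu i = (if i = 0 then \<mu>1 else if i = 1 then \<mu>2 else \<mu>3)"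
    and "sn i = (if i = 0 then s1 else if i = 1 then s2 else s3)" for i :: nat
  \<comment> \<open>Each quaternion is \<open>mu i\<close> plus \<open>sn i\<close> times a unit
    axis: \<open>i\<close>, \<open>x i + z2 j\<close> and \<open>y i + z3 j\<close> respectively.
    Indices above 2 repeat the third, as \<open>ord3\<close> does.\<close>
  define X where "X i = (if i = 0 then (Gauss (C4 \<mu>1) (C4 s1), 0, 0)
    else if i = 1 then (Gauss (C4 \<mu>2) (C4 s2 * Xv), greal (C4 s2), 0)
    else (Gauss (C4 \<mu>3) (C4 s3 * Yv), 0, greal (C4 s3)))" for i :: nat
  have norm: "C4 (sn i) ^ 2 + C4 (mu i) ^ 2 = 1" for i
    using assms(7-9) by (simp add: mu_def sn_def C4_hom flip: C4_power C4_hom(3))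
  have X: "qpow (X i) (?N i) = qone \<or> qpow (X i) (?N i) = qneg qone" for i
  proof -
    obtain a p q where Xi: "X i = (a, p, q)" by (cases "X i")
    obtain n where n: "?N i = Suc n" using N[of i] by (cases "?N i") auto
    have P: "poly (Pch k) (greal (C4 (mu i))) = greal (C4 (poly (Pch k) (mu i)))" for k
      by (rule poly_Pch_hom) (auto intro: gauss.expand simp: C4_hom)
    have "a + gcnj a = 2 * greal (C4 (mu i))"
      using Xi by (auto intro!: gauss.expand simp: X_def mu_def split: if_splits)
    moreover have "a * gcnj a + (row1 (a, p, q) * gcnj p + row2 (a, p, q) * gcnj q) = 1"
    proof -
      \<comment> \<open>The axis has norm \<open>x^2 + (1 - x^2) = 1\<close>.\<close>
      have rotation: "m * m + k * x * (k * x) + k * (1 - x^2) * k = 1"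
        if "k^2 + m^2 = 1" for m k x :: "'a mpoly4"
        using that by algebra
      have "C4 \<mu>1 * C4 \<mu>1 + C4 s1 * C4 s1 = 1"
          "C4 \<mu>2 * C4 \<mu>2 + C4 s2 * Xv * (C4 s2 * Xv) + C4 s2 * D * C4 s2 = 1"
          "C4 \<mu>3 * C4 \<mu>3 + C4 s3 * Yv * (C4 s3 * Yv) + C4 s3 * E * C4 s3 = 1"
        using norm[of 0] rotation[OF norm[of 1], of Xv] rotation[OF norm[of 2], of Yv]
        by (simp_all add: D_def E_def mu_def sn_def power2_eq_square add.commute)
      then show ?thesis using Xi by (auto intro!: gauss.expand simp: X_def split: if_splits)
    qed
    moreover have "gcnj (poly (Pch k) (greal (C4 (mu i)))) = poly (Pch k) (greal (C4 (mu i)))" for k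
      unfolding P by (auto intro: gauss.expand)
    ultimately have "qpow (X i) (?N i) =
        (greal (C4 (poly (Pch (Suc n)) (mu i))) * a - greal (C4 (poly (Pch n) (mu i))),
         greal (C4 (poly (Pch (Suc n)) (mu i))) * p, greal (C4 (poly (Pch (Suc n)) (mu i))) * q)"
      unfolding n Xi P[symmetric] by (rule qpow_Pch)
    moreover have root: "poly (Pch (Suc n)) (mu i) = 0"
      using assms(4-6) n by (auto simp: ord3_def mu_def split: if_splits)
    moreover have "greal (0 :: 'a mpoly4) = 0" "greal (1 :: 'a mpoly4) = 1" "greal (- 1 :: 'a mpoly4) = - 1"
      by (auto intro: gauss.expand)
    ultimately show ?thesis
      using Pch_root_neighbour[OF root] by (auto simp: qone_def C4_hom)
  qed

  define A where "A = word_val (\<lambda>i. qpow (X i) (f i)) w"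
  define c where "c = gim (fst A)"
  \<comment> \<open>A combination of the four real coordinates of the two rows. The coefficients
    \<open>l\<close> will serve as the left vector \<open>q1\<close> of
    \<open>bilinM\<close>.\<close>
  define rows where "rows = (\<lambda>l :: nat \<Rightarrow> 'a mpoly4. l 0 * gre (row1 A) + l 1 * gim (row1 A)
    + l 2 * gre (row2 A) + l 3 * gim (row2 A))"

  have "\<exists>g l h. 1 = g * c + rows l + h * Rrel"
  proof -
    define I where "I = {z. \<exists>g l h. z = g * c + rows l + h * Rrel}"
    have I: "g * c + rows l + h * Rrel \<in> I" for g l h by (auto simp: I_def)
    have add: "a + b \<in> I" if ab: "a \<in> I" "b \<in> I" for a b
    proof -
      obtain g l h g' l' h' where "a = g * c + rows l + h * Rrel" "b = g' * c + rows l' + h' * Rrel"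
        using ab by (auto simp: I_def)
      then have "a + b = (g + g') * c + rows (\<lambda>i. l i + l' i) + (h + h') * Rrel"
        by (simp add: rows_def algebra_simps)
      then show ?thesis using I by metis
    qed
    have mult: "b * a \<in> I" if a: "a \<in> I" for a b
    proof -
      obtain g l h where "a = g * c + rows l + h * Rrel" using a by (auto simp: I_def)
      then have "b * a = (b * g) * c + rows (\<lambda>i. b * l i) + (b * h) * Rrel"
        by (simp add: rows_def algebra_simps)
      then show ?thesis using I by metis
    qed
    have mem: "0 \<in> I" "c \<in> I" "Rrel \<in> I"
      using I[of 0 "\<lambda>_. 0" 0] I[of 1 "\<lambda>_. 0" 0] I[of 0 "\<lambda>_. 0" 1] by (simp_all add: rows_def)
    have row: "gre (row1 A) \<in> I" "gim (row1 A) \<in> I" "gre (row2 A) \<in> I" "gim (row2 A) \<in> I"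
      using I[of 0 "\<lambda>i. if i = 0 then 1 else 0" 0] I[of 0 "\<lambda>i. if i = 1 then 1 else 0" 0]
        I[of 0 "\<lambda>i. if i = 2 then 1 else 0" 0] I[of 0 "\<lambda>i. if i = 3 then 1 else 0" 0]
      by (simp_all add: rows_def)
    interpret M: hermitian_plane_ideal gcnj "greal D" "greal E" om "{a. gre a \<in> I \<and> gim a \<in> I}"
      by (rule hermitian_plane_ideal_gauss)
        (use mem add mult in \<open>auto simp: D_def E_def om_def Rrel_def\<close>)
    have near: "M.near (qpow (X i) (?N i)) qone" for i
      using X[of i] by (auto simp: M.near_def)
    \<comment> \<open>The first component of \<open>A\<close> minus its conjugate has imaginary part
      \<open>c + c\<close>.\<close>
    have "M.scalar A"
      unfolding M.scalar_def M.cg_def using mem row add[of c c] by (simp add: c_def)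
    then have "M.scalar (X 0)"
      using M.scalar_generator[OF gen near, where f = f and i = 0] f[of 0] N unfolding A_def by simp
    \<comment> \<open>Comparing \<open>fst (X 0)\<close> with its conjugate leaves twice its
      imaginary part; \<open>2 * s1\<close> is a nonzero constant, so \<open>I\<close> contains
      1.\<close>
    then have "C4 s1 + C4 s1 \<in> I" by (simp add: M.scalar_def M.cg_def X_def)
    from mult[OF this, of "C4 (1 / (2 * s1))"] have "C4 (1 / (2 * s1) * (s1 + s1)) \<in> I"
      by (simp only: C4_hom)
    then have "1 \<in> I" using s1 by (simp add: C4_hom)
    then show ?thesis by (auto simp: I_def)
  qed
  then obtain g l h where one: "1 = g * c + rows l + h * Rrel" by blast

  have "\<exists>e c1 c2 c3 c4. C4 s1 * c =
    e * (Wel \<mu>1 \<mu>2 \<mu>3 s1 s2 s3 + (c1 * Uv + c2 * Vv + c3 * (1 - Xv^2) + c4 * (1 - Yv^2)))"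
  proof -
    define J :: "'a mpoly4 set"
      where "J = {z. \<exists>c1 c2 c3 c4. z = c1 * Uv + c2 * Vv + c3 * (1 - Xv^2) + c4 * (1 - Yv^2)}"
    have J: "c1 * Uv + c2 * Vv + c3 * (1 - Xv^2) + c4 * (1 - Yv^2) \<in> J" for c1 c2 c3 c4
      by (auto simp: J_def)
    have add: "a + b \<in> J" if ab: "a \<in> J" "b \<in> J" for a b
    proof -
      obtain c1 c2 c3 c4 d1 d2 d3 d4 where
        ab': "a = c1 * Uv + c2 * Vv + c3 * (1 - Xv^2) + c4 * (1 - Yv^2)"
        "b = d1 * Uv + d2 * Vv + d3 * (1 - Xv^2) + d4 * (1 - Yv^2)"
        using ab by (auto simp: J_def)
      have "a + b = (c1 + d1) * Uv + (c2 + d2) * Vv + (c3 + d3) * (1 - Xv^2) + (c4 + d4) * (1 - Yv^2)"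
        unfolding ab' by (simp add: algebra_simps)
      then show ?thesis using J by metis
    qed
    have mult: "b * a \<in> J" if a: "a \<in> J" for a b
    proof -
      obtain c1 c2 c3 c4 where a': "a = c1 * Uv + c2 * Vv + c3 * (1 - Xv^2) + c4 * (1 - Yv^2)"
        using a by (auto simp: J_def)
      have "b * a = (b * c1) * Uv + (b * c2) * Vv + (b * c3) * (1 - Xv^2) + (b * c4) * (1 - Yv^2)"
        unfolding a' by (simp add: algebra_simps)
      then show ?thesis using J by metis
    qed
    have mem: "0 \<in> J" "Uv \<in> J" "Vv \<in> J" "1 - Xv^2 \<in> J" "1 - Yv^2 \<in> J"
      using J[of 0 0 0 0] J[of 1 0 0 0] J[of 0 1 0 0] J[of 0 0 1 0] J[of 0 0 0 1] by simp_all
    \<comment> \<open>The defining relation of \<open>A\<close> lies in \<open>J\<close>, so the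
      quaternion calculus also applies modulo \<open>J\<close>.\<close>
    have "D * E - (gre om ^ 2 + gim om ^ 2) = (- Uv) * Uv + (- Vv) * Vv + (1 - Yv^2) * (1 - Xv^2) + 0 * (1 - Yv^2)"
      by (simp add: D_def E_def om_def algebra_simps power2_eq_square)
    then have det: "D * E - (gre om ^ 2 + gim om ^ 2) \<in> J" using J by metis
    interpret M: hermitian_plane_ideal gcnj "greal D" "greal E" om "{a. gre a \<in> J \<and> gim a \<in> J}"
      by (rule hermitian_plane_ideal_gauss) (use mem(1) add mult det in auto)
    have near: "M.near (qpow (X i) (?N i)) qone" for i
      using X[of i] by (auto simp: M.near_def)
    obtain e where e: "e = 1 \<or> e = - 1" "M.cg (fst A) (e * (\<Prod>i<3. fst (X i)))"
      using M.fst_word_val_generators[OF _ _ _ w near f N] mem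
      unfolding A_def by (auto simp: D_def E_def om_def)
    define e' where "e' = gre e"
    have "gim (e * (\<Prod>i<3. fst (X i))) = e' * gim (\<Prod>i<3. fst (X i))"
      using e(1) by (auto simp: e'_def)
    \<comment> \<open>Multiplying out the first components \<open>\<mu>1 + i s1\<close>,
      \<open>\<mu>2 + i s2 x\<close>, \<open>\<mu>3 + i s3 y\<close> and taking \<open>s1\<close>
      times the imaginary part gives exactly \<open>Wel\<close>.\<close>
    moreover have W: "C4 s1 * gim (\<Prod>i<3. fst (X i)) = Wel \<mu>1 \<mu>2 \<mu>3 s1 s2 s3"
      by (simp add: numeral_3_eq_3 X_def Wel_def C4_hom C4_power algebra_simps power2_eq_square)
    ultimately have "c - e' * gim (\<Prod>i<3. fst (X i)) \<in> J"
      using e(2) by (simp add: M.cg_def c_def)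
    \<comment> \<open>The sign is its own inverse; including it in the multiplier puts the element
      of \<open>J\<close> inside the bracket next to \<open>Wel\<close>.\<close>
    from mult[OF this, of "e' * C4 s1"] obtain c1 c2 c3 c4 where
      "e' * C4 s1 * (c - e' * gim (\<Prod>i<3. fst (X i))) =
        c1 * Uv + c2 * Vv + c3 * (1 - Xv^2) + c4 * (1 - Yv^2)" by (auto simp: J_def)
    moreover have ee: "e' * e' = 1" using e(1) by (auto simp: e'_def)
    moreover have "e' * (Wel \<mu>1 \<mu>2 \<mu>3 s1 s2 s3 + e' * C4 s1 * (c - e' * gim (\<Prod>i<3. fst (X i)))) =
        (e' * e') * (C4 s1 * c) + e' * (1 - e' * e') * Wel \<mu>1 \<mu>2 \<mu>3 s1 s2 s3"
      unfolding W[symmetric] by (simp add: algebra_simps)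
    ultimately have "C4 s1 * c = e' *
        (Wel \<mu>1 \<mu>2 \<mu>3 s1 s2 s3 + (c1 * Uv + c2 * Vv + c3 * (1 - Xv^2) + c4 * (1 - Yv^2)))"
      by simp
    then show ?thesis by blast
  qed
  then obtain e c1 c2 c3 c4 where e: "C4 s1 * c =
    e * (Wel \<mu>1 \<mu>2 \<mu>3 s1 s2 s3 + (c1 * Uv + c2 * Vv + c3 * (1 - Xv^2) + c4 * (1 - Yv^2)))" by blast
  have "C4 (1 / s1) * C4 s1 = 1" using s1 by (simp add: C4_hom flip: C4_hom(6))
  then have "g * c = g * C4 (1 / s1) * (C4 s1 * c)" by (metis mult.assoc mult_1)
  also have "\<dots> = (g * C4 (1 / s1) * e) *
      (Wel \<mu>1 \<mu>2 \<mu>3 s1 s2 s3 + (c1 * Uv + c2 * Vv + c3 * (1 - Xv^2) + c4 * (1 - Yv^2)))"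
    unfolding e by (simp only: mult.assoc)
  \<comment> \<open>The right vector lists the coordinates along the third axis before those along
    the second, to match the columns of \<open>Mmat\<close>; its rows then give the real and
    imaginary parts of \<open>row1 A\<close> and \<open>row2 A\<close>.\<close>
  moreover have "rows l = bilinM l (\<lambda>j. [gre (snd (snd A)), gim (snd (snd A)),
      gre (fst (snd A)), gim (fst (snd A))] ! j)"
  proof -
    have "gre om = Uv" "gim om = Vv" by (simp_all add: om_def)
    then show ?thesis
      unfolding rows_def bilinM_def Mmat_def D_def[symmetric] E_def[symmetric]
      by (cases A) (simp add: algebra_simps eval_nat_numeral)
  qed
  \<comment> \<open>The equation \<open>one\<close> now has the excluded form, with
    \<open>f = 1\<close> and \<open>q1 = l\<close>.\<close>
  ultimately show False using one assms(10) by (metis add.commute mult_1)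
qed

end
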